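(* Let $\mathfrak{v}=\{\nu_i\}_{i\in I}$ be a totally ordered set in $\mathcal{V}$ such that every $f\in\mathbb{K}[x]$ is $\mathfrak{v}$-stable. Define $\nu=\sup_{i\in I}\nu_i:\mathbb{K}[x]\to\Gamma_\infty$ by $\nu(f)=\nu_{i_f}(f)$, where $i_f\in I$ is any index such that $\nu_i(f)=\nu_{i_f}(f)$ for all $i\ge i_f$. Then $\nu$ is a valuation on $\mathbb{K}[x]$ such that $\nu_i\le\nu$ for every $i\in I$. Moreover, if $\nu'\in\mathcal{V}$ is such that $\nu'\le\nu$ and $\nu_i\le\nu'$ for every $i\in I$, then $\nu'=\nu$.
   Context: A valuation on a commutative ring $A$ with unity is a map $\nu:A\to\Gamma_\infty=\Gamma\cup\{\infty\}$, with $\Gamma$ a totally ordered abelian group, such that $\nu(ab)=\nu(a)+\nu(b)$, $\nu(a+b)\ge\min\{\nu(a),\nu(b)\}$, $\nu(1)=0$, $\nu(0)=\infty$ (non-zero elements may have value $\infty$). Let $\mathbb{K}$ be a field, $\nu_0$ a valuation on $\mathbb{K}$ with value group $\Gamma_0$ (taking the value $\infty$ only at $0$), and fix a totally ordered divisible abelian group $\Gamma\supseteq\Gamma_0$. Put $\mathcal{V}=\{\nu_0\}\cup\{\nu:\mathbb{K}[x]\to\Gamma_\infty\mid \nu\text{ is a valuation extending }\nu_0\}$, partially ordered by $\nu_0\le\nu$ for all $\nu\in\mathcal{V}$, and, for $\nu,\mu\in\mathcal{V}\setminus\{\nu_0\}$, $\nu\le\mu$ iff $\nu(f)\le\mu(f)$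 for all $f\in\mathbb{K}[x]$. The families $\mathfrak{v}=\{\nu_i\}_{i\in I}$ considered are non-empty and consist of valuations on $\mathbb{K}[x]$; $I$ carries the induced total order ($i\le j$ iff $\nu_i\le\nu_j$). A polynomial $f\in\mathbb{K}[x]$ is $\mathfrak{v}$-stable if there is $i_f\in I$ with $\nu_i(f)=\nu_{i_f}(f)$ for every $i\in I$ with $i\ge i_f$. *)

theory Defs
  imports "HOL-Computational_Algebra.Polynomial"
begin

datatype 'g with_infty = Fin 'g | Infty

instantiation with_infty :: (linorder) linorder
begin

fun less_eq_with_infty :: "'a with_infty \<Rightarrow> 'a with_infty \<Rightarrow> bool" where
  "_ \<le> Infty \<longleftrightarrow> True"
| "Infty \<le> Fin _ \<longleftrightarrow> False"
| "Fin a \<le> Fin b \<longleftrightarrow> a \<le> b"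

definition less_with_infty :: "'a with_infty \<Rightarrow> 'a with_infty \<Rightarrow> bool" where
  "x < y \<longleftrightarrow> x \<le> y \<and> \<not> y \<le> (x :: 'a with_infty)"

instance
proof
  fix x y z :: "'a with_infty"
  show "x < y \<longleftrightarrow> x \<le> y \<and> \<not> y \<le> x"
    by (rule less_with_infty_def)
  show "x \<le> x"
    by (cases x) auto
  show "x \<le> y \<Longrightarrow> y \<le> z \<Longrightarrow> x \<le> z"
    by (cases x; cases y; cases z) auto
  show "x \<le> y \<Longrightarrow> y \<le> x \<Longrightarrow> x = y"
    by (cases x; cases y) auto
  show "x \<le> y \<or> y \<le> x"
    by (cases x; cases y) auto
qed

end

instantiation with_infty :: (comm_monoid_add) comm_monoid_add
begin

definition zero_with_infty :: "'a with_infty" where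
  "0 = Fin 0"

fun plus_with_infty :: "'a with_infty \<Rightarrow> 'a with_infty \<Rightarrow> 'a with_infty" where
  "Fin a + Fin b = Fin (a + b)"
| "Infty + _ = Infty"
| "_ + Infty = Infty"

instance
proof
  fix x y z :: "'a with_infty"
  show "x + y + z = x + (y + z)"
    by (cases x; cases y; cases z) (auto simp: add.assoc)
  show "x + y = y + x"
    by (cases x; cases y) (auto simp: add.commute)
  show "0 + x = x"
    by (cases x) (auto simp: zero_with_infty_def)
qed

end

text \<open>The sum in the axiom is the multiple \<open>n h\<close>.\<close>

class divisible_linordered_ab_group_add = linordered_ab_group_add +
  assumes divisible: "n > 0 \<Longrightarrow> \<exists>h. (\<Sum>i<(n::nat). h) = g"

definition valuation ::
  "('a::comm_ring_1 \<Rightarrow> 'g::linordered_ab_group_add with_infty) \<Rightarrow> bool" where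
  "valuation \<nu> \<longleftrightarrow>
     (\<forall>a b. \<nu> (a * b) = \<nu> a + \<nu> b) \<and>
     (\<forall>a b. \<nu> (a + b) \<ge> min (\<nu> a) (\<nu> b)) \<and>
     \<nu> 1 = 0 \<and> \<nu> 0 = Infty"

definition extends ::
  "('k::field poly \<Rightarrow> 'g with_infty) \<Rightarrow> ('k \<Rightarrow> 'g with_infty) \<Rightarrow> bool" where
  "extends \<nu> \<nu>\<^sub>0 \<longleftrightarrow> (\<forall>a. \<nu> [:a:] = \<nu>\<^sub>0 a)"

text \<open>
  The base valuation lives on the field and the others on the polynomial ring, so the
  poset \<open>\<V>\<close> is a subset of a sum type: \<open>Inl\<close> tags the base valuation, \<open>Inr\<close> the
  valuations on polynomials.
\<close>

type_synonym ('k, 'g) vals = "('k \<Rightarrow> 'g with_infty) + ('k poly \<Rightarrow> 'g with_infty)"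

definition \<V> ::
  "('k::field \<Rightarrow> 'g::linordered_ab_group_add with_infty) \<Rightarrow> ('k, 'g) vals set" where
  "\<V> \<nu>\<^sub>0 = {Inl \<nu>\<^sub>0} \<union> Inr ` {\<nu>. valuation \<nu> \<and> extends \<nu> \<nu>\<^sub>0}"

fun vals_le ::
  "('k::field, 'g::linordered_ab_group_add) vals \<Rightarrow> ('k, 'g) vals \<Rightarrow> bool"
  (infix "\<preceq>" 50) where
  "Inl _ \<preceq> _ \<longleftrightarrow> True"
| "Inr _ \<preceq> Inl _ \<longleftrightarrow> False"
| "Inr \<nu> \<preceq> Inr \<mu> \<longleftrightarrow> (\<forall>f. \<nu> f \<le> \<mu> f)"

definition stable_index ::
  "'i::linorder set \<Rightarrow> ('i \<Rightarrow> 'k::field poly \<Rightarrow> 'g with_infty) \<Rightarrow> 'k poly \<Rightarrow> 'i \<Rightarrow> bool" where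
  "stable_index I \<nu> f i \<longleftrightarrow> i \<in> I \<and> (\<forall>j\<in>I. j \<ge> i \<longrightarrow> \<nu> j f = \<nu> i f)"

definition stable_poly ::
  "'i::linorder set \<Rightarrow> ('i \<Rightarrow> 'k::field poly \<Rightarrow> 'g with_infty) \<Rightarrow> 'k poly \<Rightarrow> bool" where
  "stable_poly I \<nu> f \<longleftrightarrow> (\<exists>i. stable_index I \<nu> f i)"

definition stable_sup ::
  "'i::linorder set \<Rightarrow> ('i \<Rightarrow> 'k::field poly \<Rightarrow> 'g with_infty) \<Rightarrow> 'k poly \<Rightarrow> 'g with_infty" where
  "stable_sup I \<nu> f = \<nu> (SOME i. stable_index I \<nu> f i) f"

end

theory Submission
  imports Defs
begin

text \<open>
  Stability propagates upwards along the index set, which is totally ordered, so any finitely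
  many polynomials are stabilized by one common index. On these polynomials the supremum
  coincides with the single member of the family at that index. Each valuation axiom, like the
  condition of extending the base valuation, involves only finitely many polynomials and is
  therefore inherited from that member (\<open>finite_stabilization\<close>).

  The supremum dominates the family because the values of each polynomial increase along the
  family until they reach the stable one. As this stable value is attained within the family,
  every upper bound of the family dominates the supremum as well, which leaves no room for an
  upper bound strictly below it.
\<close>

lemma stable_index_mem: "stable_index I \<nu> f i \<Longrightarrow> i \<in> I"
  unfolding stable_index_def by (rule conjunct1)

lemma stable_index_mono:
  assumes "stable_index I \<nu> f i" and "j \<in> I" and "i \<le> j"
  shows "stable_index I \<nu> f j"
proof -
  have "\<nu> k f = \<nu> i f" if "k \<in> I" and "i \<le> k" for k
    using assms(1) that unfolding stable_index_def by blast
  then show ?thesis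
    using assms(2,3) unfolding stable_index_def by (metis order_trans)
qed

text \<open>Two stable indices are comparable, and the smaller one already sees the value at the larger.\<close>

lemma stable_sup_eq:
  assumes "stable_index I \<nu> f i"
  shows "stable_sup I \<nu> f = \<nu> i f"
  unfolding stable_sup_def
proof (rule someI2)
  show "stable_index I \<nu> f i"
    by (fact assms)
next
  fix k
  assume "stable_index I \<nu> f k"
  with assms linear[of i k] show "\<nu> k f = \<nu> i f"
    unfolding stable_index_def by metis
qed

text \<open>
  This reduces every statement about finitely many values of the supremum to the same statement
  about a single member of the family.
\<close>

lemma finite_stabilization:
  assumes "\<And>f. stable_poly I \<nu> f" and "finite F"
  obtains i where "i \<in> I" and "\<And>f. f \<in> F \<Longrightarrow> stable_sup I \<nu> f = \<nu> i f"
proof -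
  have "\<exists>i\<in>I. \<forall>f\<in>F. stable_index I \<nu> f i"
    using \<open>finite F\<close>
  proof induction
    case empty
    show ?case
      using assms(1) unfolding stable_poly_def by (blast dest: stable_index_mem)
  next
    case (insert g F)
    then obtain i where i: "i \<in> I" "\<forall>f\<in>F. stable_index I \<nu> f i"
      by blast
    obtain j where j: "stable_index I \<nu> g j" "j \<in> I"
      using assms(1) unfolding stable_poly_def by (blast dest: stable_index_mem)
    have "max i j \<in> I"
      using i(1) j(2) by (simp add: max_def)
    then show ?case
      using i(2) j(1) by (intro bexI[of _ "max i j"]) (auto intro: stable_index_mono)
  qed
  then show thesis
    using that stable_sup_eq by blast
qed

lemma valuation_stable_sup:
  fixes \<nu> :: "'i::linorder \<Rightarrow> 'k::field poly \<Rightarrow> 'g::linordered_ab_group_add with_infty"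
  assumes stable: "\<And>f. stable_poly I \<nu> f"
    and val: "\<And>i. i \<in> I \<Longrightarrow> valuation (\<nu> i)"
  shows "valuation (stable_sup I \<nu>)"
  unfolding valuation_def
proof (intro conjI allI)
  fix a b :: "'k poly"
  obtain i where "i \<in> I"
    and eq: "\<And>f. f \<in> {a, b, a * b, a + b, 1, 0} \<Longrightarrow> stable_sup I \<nu> f = \<nu> i f"
    using finite_stabilization[OF stable, of "{a, b, a * b, a + b, 1, 0}"] by blast
  have "valuation (\<nu> i)"
    using \<open>i \<in> I\<close> by (rule val)
  then show "stable_sup I \<nu> (a * b) = stable_sup I \<nu> a + stable_sup I \<nu> b"
    and "min (stable_sup I \<nu> a) (stable_sup I \<nu> b) \<le> stable_sup I \<nu> (a + b)"
    and "stable_sup I \<nu> 1 = 0" and "stable_sup I \<nu> 0 = Infty"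
    by (simp_all add: eq valuation_def)
qed

lemma extends_stable_sup:
  assumes "\<And>f. stable_poly I \<nu> f"
    and "\<And>i. i \<in> I \<Longrightarrow> extends (\<nu> i) \<nu>\<^sub>0"
  shows "extends (stable_sup I \<nu>) \<nu>\<^sub>0"
  unfolding extends_def
proof
  fix a
  obtain i where "i \<in> I" "stable_sup I \<nu> [:a:] = \<nu> i [:a:]"
    using finite_stabilization[OF assms(1), of "{[:a:]}"] by blast
  then show "stable_sup I \<nu> [:a:] = \<nu>\<^sub>0 a"
    using assms(2) by (simp add: extends_def)
qed

lemma le_stable_sup:
  assumes "stable_poly I \<nu> f" and "i \<in> I"
    and mono: "\<And>i j. i \<in> I \<Longrightarrow> j \<in> I \<Longrightarrow> i \<le> j \<Longrightarrow> \<nu> i f \<le> \<nu> j f"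
  shows "\<nu> i f \<le> stable_sup I \<nu> f"
proof -
  obtain j where j: "stable_index I \<nu> f j" "j \<in> I"
    using assms(1) unfolding stable_poly_def by (blast dest: stable_index_mem)
  have m: "max i j \<in> I"
    using j(2) assms(2) by (simp add: max_def)
  then have "stable_index I \<nu> f (max i j)"
    using j(1) by (auto intro: stable_index_mono)
  then have "stable_sup I \<nu> f = \<nu> (max i j) f"
    by (rule stable_sup_eq)
  then show ?thesis
    using mono[OF assms(2) m] by simp
qed

text \<open>The value of the supremum at each polynomial is attained by a member of the family.\<close>

lemma stable_sup_le:
  assumes "stable_poly I \<nu> f" and "\<And>i. i \<in> I \<Longrightarrow> \<nu> i f \<le> c"
  shows "stable_sup I \<nu> f \<le> c"
proof -
  obtain j where "stable_index I \<nu> f j"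
    using assms(1) by (auto simp: stable_poly_def)
  then show ?thesis
    using assms(2) by (simp add: stable_sup_eq stable_index_mem)
qed

theorem proposition4p9:
  fixes \<nu>\<^sub>0 :: "'k::field \<Rightarrow> 'g::divisible_linordered_ab_group_add with_infty"
    and I :: "'i::linorder set"
    and \<nu> :: "'i \<Rightarrow> 'k poly \<Rightarrow> 'g with_infty"
  assumes "valuation \<nu>\<^sub>0"
    and "\<And>a. \<nu>\<^sub>0 a = Infty \<Longrightarrow> a = 0"
    and "I \<noteq> {}"
    and "\<And>i. i \<in> I \<Longrightarrow> Inr (\<nu> i) \<in> \<V> \<nu>\<^sub>0"
    and "Complete_Partial_Order.chain (\<preceq>) ((\<lambda>i. Inr (\<nu> i)) ` I)"
    and "\<And>i j. i \<in> I \<Longrightarrow> j \<in> I \<Longrightarrow> i \<le> j \<longleftrightarrow> Inr (\<nu> i) \<preceq> Inr (\<nu> j)"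
    and "\<And>f. stable_poly I \<nu> f"
  shows "(\<forall>f i. stable_index I \<nu> f i \<longrightarrow> stable_sup I \<nu> f = \<nu> i f) \<and>
    valuation (stable_sup I \<nu>) \<and>
    Inr (stable_sup I \<nu>) \<in> \<V> \<nu>\<^sub>0 \<and>
    (\<forall>i\<in>I. Inr (\<nu> i) \<preceq> Inr (stable_sup I \<nu>)) \<and>
    (\<forall>\<nu>'\<in>\<V> \<nu>\<^sub>0. \<nu>' \<preceq> Inr (stable_sup I \<nu>) \<and> (\<forall>i\<in>I. Inr (\<nu> i) \<preceq> \<nu>')
        \<longrightarrow> \<nu>' = Inr (stable_sup I \<nu>))"
proof -
  have val: "valuation (\<nu> i)" and ext: "extends (\<nu> i) \<nu>\<^sub>0" if "i \<in> I" for i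
    using assms(4)[OF that] by (auto simp: \<V>_def)
  have mono: "\<nu> i f \<le> \<nu> j f" if "i \<in> I" "j \<in> I" "i \<le> j" for i j f
    using assms(6)[OF that(1,2)] that(3) by simp
  have valuation: "valuation (stable_sup I \<nu>)"
    using assms(7) val by (rule valuation_stable_sup)
  have "extends (stable_sup I \<nu>) \<nu>\<^sub>0"
    using assms(7) ext by (rule extends_stable_sup)
  with valuation have mem: "Inr (stable_sup I \<nu>) \<in> \<V> \<nu>\<^sub>0"
    by (simp add: \<V>_def)
  have upper: "\<forall>i\<in>I. Inr (\<nu> i) \<preceq> Inr (stable_sup I \<nu>)"
    using le_stable_sup[OF assms(7)] mono by simp
  have minimal: "\<nu>' = Inr (stable_sup I \<nu>)"
    if le: "\<nu>' \<preceq> Inr (stable_sup I \<nu>)" and ge: "\<forall>i\<in>I. Inr (\<nu> i) \<preceq> \<nu>'" for \<nu>'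
  proof (cases \<nu>')
    (* The base valuation lies below every valuation on polynomials, so it bounds only the
       empty family. *)
    case (Inl a)
    with ge \<open>I \<noteq> {}\<close> show ?thesis
      by auto
  next
    case (Inr \<mu>)
    have "\<mu> f = stable_sup I \<nu> f" for f
    proof (rule antisym)
      show "\<mu> f \<le> stable_sup I \<nu> f"
        using le Inr by simp
      show "stable_sup I \<nu> f \<le> \<mu> f"
        using ge Inr by (intro stable_sup_le assms(7)) simp
    qed
    with Inr show ?thesis
      by auto
  qed
  show ?thesis
    by (intro conjI allI ballI impI valuation mem upper) (blast intro: stable_sup_eq minimal)+
qed

end
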